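(* There is a (randomized) algorithm which, given subcube-conditioning ($\mathsf{SUBCOND}$) oracle access to two distributions $\mathcal{P}$ and $\mathcal{Q}$ over $\{0,1\}^n$, and parameters $\varepsilon_1 \in [0,1)$ and $\varepsilon_2 \in (\varepsilon_1, 1]$, makes at most $\tilde{O}\left(n^3/(\varepsilon_2-\varepsilon_1)^5\right)$ oracle queries and, with probability at least $3/5$, outputs Accept if $d_{TV}(\mathcal{P},\mathcal{Q}) < \varepsilon_1$ and outputs Reject if $d_{TV}(\mathcal{P},\mathcal{Q}) > \varepsilon_2$.
   Context: For a query string $\rho \in \{0,1,*\}^n$, the subcube $S_\rho$ is the set of $w\in\{0,1\}^n$ with $w[i]=\rho[i]$ for every $i$ with $\rho[i]\neq *$. For a distribution $\mathcal{D}$ on $\{0,1\}^n$, the conditional distribution $\mathcal{D}_\rho$ is $\mathcal{D}_\rho(w)=\mathcal{D}(w)/\mathcal{D}(S_\rho)$ for $w\in S_\rho$. A $\mathsf{SUBCOND}$ oracle for $\mathcal{D}$ takes as input any $\rho\in\{0,1,*\}^n$ and returns an independent sample $w\sim\mathcal{D}_\rho$. The total variation distance is $d_{TV}(\mathcal{D}_1,\mathcal{D}_2)=\frac12\sum_{\sigma\in\{0,1\}^n}|\mathcal{D}_1(\sigma)-\mathcal{D}_2(\sigma)|$. $\tilde{O}$ hides polylogarithmic factors. *)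

theory Defs
  imports "HOL-Probability.Probability" "HOL-Library.Landau_Symbols"
begin

definition bitstrings :: "nat \<Rightarrow> bool list set" where
  "bitstrings n = {w. length w = n}"

text \<open>A query string over \<open>{0,1,*}\<close> is a list of type \<^typ>\<open>bool option list\<close>; \<^const>\<open>None\<close> is \<open>*\<close>.\<close>

definition subcube :: "nat \<Rightarrow> bool option list \<Rightarrow> bool list set" where
  "subcube n \<rho> = {w \<in> bitstrings n. \<forall>i<n. \<rho> ! i \<noteq> None \<longrightarrow> \<rho> ! i = Some (w ! i)}"

definition distr_on_cube :: "nat \<Rightarrow> bool list pmf \<Rightarrow> bool" where
  "distr_on_cube n D \<longleftrightarrow> set_pmf D \<subseteq> bitstrings n"

definition d_TV :: "nat \<Rightarrow> bool list pmf \<Rightarrow> bool list pmf \<Rightarrow> real" where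
  "d_TV n D1 D2 = 1 / 2 * (\<Sum>\<sigma>\<in>bitstrings n. \<bar>pmf D1 \<sigma> - pmf D2 \<sigma>\<bar>)"

type_synonym subcond = "bool option list \<Rightarrow> bool list pmf"

text \<open>The conditional distribution on a subcube of mass zero is undefined. An oracle may answer such
  a query by a sample from any distribution on the cube, so a statement about all oracles for \<open>D\<close>
  depends on no convention for that case.\<close>

definition subcond_oracle :: "nat \<Rightarrow> bool list pmf \<Rightarrow> subcond \<Rightarrow> bool" where
  "subcond_oracle n D orc \<longleftrightarrow>
     (\<forall>\<rho>. length \<rho> = n \<longrightarrow>
        distr_on_cube n (orc \<rho>) \<and>
        (measure_pmf.prob D (subcube n \<rho>) > 0 \<longrightarrow> orc \<rho> = cond_pmf D (subcube n \<rho>)))"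

datatype verdict = Accept | Reject

text \<open>A randomized adaptive query algorithm with access to two oracles, as a well-founded tree:
  each step tosses a fair coin or queries one of the oracles, and the continuation may depend on
  everything seen so far.\<close>

datatype tester =
    Output verdict
  | Toss "bool \<Rightarrow> tester"
  | QueryP "bool option list" "bool list \<Rightarrow> tester"
  | QueryQ "bool option list" "bool list \<Rightarrow> tester"

primrec queries_of_length :: "nat \<Rightarrow> tester \<Rightarrow> bool" where
  "queries_of_length n (Output v) \<longleftrightarrow> True"
| "queries_of_length n (Toss k) \<longleftrightarrow> (\<forall>b. queries_of_length n (k b))"
| "queries_of_length n (QueryP \<rho> k) \<longleftrightarrow> length \<rho> = n \<and> (\<forall>w. queries_of_length n (k w))"
| "queries_of_length n (QueryQ \<rho> k) \<longleftrightarrow> length \<rho> = n \<and> (\<forall>w. queries_of_length n (k w))"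

text \<open>Joint distribution of the verdict and the number of oracle queries made. Every oracle call
  draws a fresh sample.\<close>

primrec run :: "subcond \<Rightarrow> subcond \<Rightarrow> tester \<Rightarrow> (verdict \<times> nat) pmf" where
  "run OP OQ (Output v) = return_pmf (v, 0)"
| "run OP OQ (Toss k) = bind_pmf (bernoulli_pmf (1 / 2)) (\<lambda>b. run OP OQ (k b))"
| "run OP OQ (QueryP \<rho> k) = bind_pmf (OP \<rho>) (\<lambda>w. map_pmf (apsnd Suc) (run OP OQ (k w)))"
| "run OP OQ (QueryQ \<rho> k) = bind_pmf (OQ \<rho>) (\<lambda>w. map_pmf (apsnd Suc) (run OP OQ (k w)))"

definition prob_output :: "subcond \<Rightarrow> subcond \<Rightarrow> tester \<Rightarrow> verdict \<Rightarrow> real" where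
  "prob_output OP OQ t v = measure_pmf.prob (run OP OQ t) {r. fst r = v}"

text \<open>\<open>O\<close> up to polylogarithmic factors. The filter \<^term>\<open>principal A\<close> makes the implied constant
  and exponent uniform over all of \<open>A\<close>; the shift by 2 keeps the logarithm at least 1.\<close>

definition soft_bigo :: "'a set \<Rightarrow> ('a \<Rightarrow> real) \<Rightarrow> ('a \<Rightarrow> real) set" where
  "soft_bigo A g = {f. \<exists>k::nat. f \<in> O[principal A](\<lambda>x. g x * log 2 (2 + g x) ^ k)}"

definition tester_params :: "(nat \<times> real \<times> real) set" where
  "tester_params = {(n, \<epsilon>1, \<epsilon>2). 0 \<le> \<epsilon>1 \<and> \<epsilon>1 < 1 \<and> \<epsilon>1 < \<epsilon>2 \<and> \<epsilon>2 \<le> 1}"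

end

theory Submission
  imports Defs
begin

text \<open>
  The distance is \<open>d\<^sub>T\<^sub>V(P, Q) = E\<^bsub>w \<sim> P\<^esub> max(0, 1 - Q(w)/P(w))\<close>, and by the chain rule
  \<open>P(w)\<close> and \<open>Q(w)\<close> are products of \<open>n\<close> conditional marginals, each of which is the bias of a bit that a
  subcube query samples. Every marginal \<open>q\<close> is estimated by \<open>(1 - \<eta>) q' + \<eta>/2\<close>, where \<open>q'\<close> is an
  empirical frequency over \<open>N\<close> queries and \<open>\<eta> \<approx> \<epsilon>/n\<close>, with \<open>\<epsilon> = \<epsilon>2 - \<epsilon>1\<close>. Taming the marginals in this
  way moves the distribution by at most \<open>n\<eta>\<close> in total variation and bounds the relative variance of a
  factor by \<open>2/(\<eta>N)\<close>. The factors are independent, so \<open>N \<approx> n\<^sup>2/\<epsilon>\<^sup>3\<close> makes the relative \<open>L\<^sup>2\<close> error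
  of the whole product \<open>O(\<epsilon>)\<close>. Since \<open>max(0, 1 - b/a)\<close> is 1-Lipschitz in the relative error of \<open>a\<close> and
  of \<open>b\<close>, one sample \<open>w\<close> yields a \<open>[0,1]\<close>-valued estimate of the distance with bias \<open>O(\<epsilon>)\<close>, and by
  Chebyshev's inequality averaging \<open>O(1/\<epsilon>\<^sup>2)\<close> of them suffices.
\<close>

subsection \<open>Testers as probabilistic programs\<close>

text \<open>A randomized subroutine is written in continuation-passing style; it implements the
  distribution of the value handed to the continuation, at a fixed cost of \<open>c\<close> queries.\<close>

definition implements ::
    "nat \<Rightarrow> subcond \<Rightarrow> subcond \<Rightarrow> (('a \<Rightarrow> tester) \<Rightarrow> tester) \<Rightarrow> 'a pmf \<Rightarrow> nat \<Rightarrow> bool" where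
  "implements n OP OQ t D c \<longleftrightarrow>
     (\<forall>k. run OP OQ (t k) = bind_pmf D (\<lambda>x. map_pmf (apsnd (\<lambda>q. q + c)) (run OP OQ (k x)))) \<and>
     (\<forall>k. (\<forall>x. queries_of_length n (k x)) \<longrightarrow> queries_of_length n (t k))"

lemma implements_return: "implements n OP OQ (\<lambda>k. k x) (return_pmf x) 0"
  by (auto simp: implements_def bind_return_pmf apsnd_def map_prod_def)

lemma implements_QueryP: "length \<rho> = n \<Longrightarrow> implements n OP OQ (QueryP \<rho>) (OP \<rho>) 1"
  by (auto simp: implements_def)

lemma implements_QueryQ: "length \<rho> = n \<Longrightarrow> implements n OP OQ (QueryQ \<rho>) (OQ \<rho>) 1"
  by (auto simp: implements_def)

text \<open>Associativity of \<open>bind_pmf\<close> does the work. The cost \<open>d\<close> is the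
  same for every value \<open>x\<close>, so the costs simply add and the total is
  deterministic.\<close>

lemma implements_bind:
  assumes t: "implements n OP OQ t D c" and f: "\<And>x. implements n OP OQ (f x) (E x) d"
  shows "implements n OP OQ (\<lambda>k. t (\<lambda>x. f x k)) (bind_pmf D E) (c + d)"
proof -
  have "run OP OQ (t (\<lambda>x. f x k)) =
      bind_pmf (bind_pmf D E) (\<lambda>y. map_pmf (apsnd (\<lambda>q. q + (c + d))) (run OP OQ (k y)))" for k
  proof -
    have comp: "apsnd (\<lambda>q. q + c) (apsnd (\<lambda>q. q + d) z) = apsnd (\<lambda>q. q + (c + d)) z"
      for z :: "verdict \<times> nat"
      by (cases z) simp
    have "run OP OQ (t (\<lambda>x. f x k)) =
        bind_pmf D (\<lambda>x. map_pmf (apsnd (\<lambda>q. q + c)) (run OP OQ (f x k)))"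
      using t by (auto simp: implements_def)
    also have "\<dots> = bind_pmf D (\<lambda>x. bind_pmf (E x)
        (\<lambda>y. map_pmf (apsnd (\<lambda>q. q + (c + d))) (run OP OQ (k y))))"
      using f by (simp add: implements_def map_bind_pmf pmf.map_comp o_def comp)
    finally show ?thesis
      by (simp add: bind_assoc_pmf)
  qed
  then show ?thesis
    using t f by (auto simp: implements_def)
qed

lemma implements_map:
  assumes "implements n OP OQ t D c"
  shows "implements n OP OQ (\<lambda>k. t (\<lambda>x. k (f x))) (map_pmf f D) c"
  using implements_bind[OF assms implements_return, of f] by (simp add: map_pmf_def)

section \<open>Programs and laws of sums and products of independent draws\<close>

primrec sum_prog :: "nat \<Rightarrow> ((real \<Rightarrow> tester) \<Rightarrow> tester) \<Rightarrow> (real \<Rightarrow> tester) \<Rightarrow> tester" where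
  "sum_prog 0 t = (\<lambda>k. k 0)"
| "sum_prog (Suc N) t = (\<lambda>k. t (\<lambda>x. sum_prog N t (\<lambda>s. k (x + s))))"

text \<open>Law of a sum of \<open>N\<close> independent copies of \<open>D\<close>, with the same
  recursion as \<open>sum_prog\<close>, so that program and law are matched by induction.\<close>

primrec sum_pmf :: "nat \<Rightarrow> real pmf \<Rightarrow> real pmf" where
  "sum_pmf 0 D = return_pmf 0"
| "sum_pmf (Suc N) D = bind_pmf D (\<lambda>x. map_pmf ((+) x) (sum_pmf N D))"

primrec prod_prog :: "nat \<Rightarrow> (nat \<Rightarrow> (real \<Rightarrow> tester) \<Rightarrow> tester) \<Rightarrow> (real \<Rightarrow> tester) \<Rightarrow> tester" where
  "prod_prog 0 t = (\<lambda>k. k 1)"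
| "prod_prog (Suc j) t = (\<lambda>k. t j (\<lambda>x. prod_prog j t (\<lambda>s. k (x * s))))"

primrec indep_prod_pmf :: "nat \<Rightarrow> (nat \<Rightarrow> real pmf) \<Rightarrow> real pmf" where
  "indep_prod_pmf 0 D = return_pmf 1"
| "indep_prod_pmf (Suc j) D = bind_pmf (D j) (\<lambda>x. map_pmf ((*) x) (indep_prod_pmf j D))"

lemma implements_sum_prog:
  assumes "implements n OP OQ t D c"
  shows "implements n OP OQ (sum_prog N t) (sum_pmf N D) (N * c)"
proof (induction N)
  case 0
  show ?case using implements_return by simp
next
  case (Suc N)
  show ?case
    using implements_bind[OF assms implements_map[OF Suc.IH]] by simp
qed

lemma implements_prod_prog:
  assumes "\<And>i. implements n OP OQ (t i) (D i) c"
  shows "implements n OP OQ (prod_prog j t) (indep_prod_pmf j D) (j * c)"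
proof (induction j)
  case 0
  show ?case using implements_return by simp
next
  case (Suc j)
  show ?case
    using implements_bind[OF assms implements_map[OF Suc.IH]] by simp
qed

subsection \<open>Moments of independent sums and products\<close>

text \<open>Every expectation below is over a finitely supported distribution, so Fubini comes
  without integrability conditions.\<close>

lemma expectation_bind_finite:
  fixes h :: "'b \<Rightarrow> real"
  assumes "finite (set_pmf D)" "\<And>x. x \<in> set_pmf D \<Longrightarrow> finite (set_pmf (E x))"
  shows "measure_pmf.expectation (bind_pmf D E) h =
    measure_pmf.expectation D (\<lambda>x. measure_pmf.expectation (E x) h)"
  using assms by (simp add: pmf_expectation_bind[of "set_pmf D"] integral_measure_pmf[of "set_pmf D"])

lemma expectation_mono_finite:
  fixes f g :: "'a \<Rightarrow> real"
  assumes "finite (set_pmf D)" "\<And>x. x \<in> set_pmf D \<Longrightarrow> f x \<le> g x"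
  shows "measure_pmf.expectation D f \<le> measure_pmf.expectation D g"
  using assms by (intro integral_mono_AE) (auto simp: AE_measure_pmf_iff integrable_measure_pmf_finite)

lemma finite_set_sum_pmf: "finite (set_pmf D) \<Longrightarrow> finite (set_pmf (sum_pmf N D))"
  by (induction N) auto

lemma finite_set_indep_prod:
  "(\<And>i. i < j \<Longrightarrow> finite (set_pmf (D i))) \<Longrightarrow> finite (set_pmf (indep_prod_pmf j D))"
  by (induction j) auto

lemma sum_pmf_expectation:
  assumes fin: "finite (set_pmf D)"
  shows "measure_pmf.expectation (sum_pmf N D) (\<lambda>s. s) = N * measure_pmf.expectation D (\<lambda>x. x)"
proof (induction N)
  case 0
  show ?case by simp
next
  case (Suc N)
  note [simp] = fin finite_set_sum_pmf[OF fin] integrable_measure_pmf_finite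
  show ?case
    using Suc.IH by (simp add: expectation_bind_finite algebra_simps)
qed

lemma sum_pmf_variance:
  assumes fin: "finite (set_pmf D)"
  defines "\<mu> \<equiv> measure_pmf.expectation D (\<lambda>x. x)"
  shows "measure_pmf.expectation (sum_pmf N D) (\<lambda>s. (s - N * \<mu>)\<^sup>2) =
    N * measure_pmf.expectation D (\<lambda>x. (x - \<mu>)\<^sup>2)"
proof (induction N)
  case 0
  show ?case by simp
next
  case (Suc N)
  note [simp] = fin finite_set_sum_pmf[OF fin] integrable_measure_pmf_finite
  let ?S = "measure_pmf.expectation (sum_pmf N D)" and ?D = "measure_pmf.expectation D"
  have center: "?S (\<lambda>s. s - N * \<mu>) = 0"
    using sum_pmf_expectation[OF fin, of N] by (simp add: \<mu>_def)
  \<comment> \<open>Expanding the square around the first draw leaves a cross term proportional to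
    \<open>?S (\<lambda>s. s - N * \<mu>)\<close>, which \<open>center\<close> makes zero.\<close>
  have inner: "?S (\<lambda>s. (x + s - Suc N * \<mu>)\<^sup>2) = (x - \<mu>)\<^sup>2 + ?S (\<lambda>s. (s - N * \<mu>)\<^sup>2)" for x
  proof -
    have "?S (\<lambda>s. (x + s - Suc N * \<mu>)\<^sup>2) =
        ?S (\<lambda>s. (x - \<mu>)\<^sup>2 + (2 * (x - \<mu>) * (s - N * \<mu>) + (s - N * \<mu>)\<^sup>2))"
      by (intro arg_cong[where f = ?S] ext) (simp add: power2_eq_square algebra_simps)
    also have "\<dots> = (x - \<mu>)\<^sup>2 + (2 * (x - \<mu>) * ?S (\<lambda>s. s - N * \<mu>) + ?S (\<lambda>s. (s - N * \<mu>)\<^sup>2))"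
      by (simp del: Bochner_Integration.integral_diff)
    finally show ?thesis by (simp add: center)
  qed
  have "measure_pmf.expectation (sum_pmf (Suc N) D) (\<lambda>s. (s - Suc N * \<mu>)\<^sup>2) =
      ?D (\<lambda>x. ?S (\<lambda>s. (x + s - Suc N * \<mu>)\<^sup>2))"
    by (simp add: expectation_bind_finite)
  also have "\<dots> = ?D (\<lambda>x. (x - \<mu>)\<^sup>2) + ?S (\<lambda>s. (s - N * \<mu>)\<^sup>2)"
    by (simp only: inner) simp
  finally show ?case
    unfolding Suc.IH by (simp add: distrib_right)
qed

text \<open>Independence turns moments of a product into products of moments. It is applied with
  \<open>e = 1\<close> for the mean and \<open>e = 2\<close> for the second moment.\<close>

lemma indep_prod_expectation_power:
  assumes "\<And>i. i < j \<Longrightarrow> finite (set_pmf (D i))"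
  shows "measure_pmf.expectation (indep_prod_pmf j D) (\<lambda>s. s ^ e) =
    (\<Prod>i<j. measure_pmf.expectation (D i) (\<lambda>x. x ^ e))"
  using assms
proof (induction j)
  case 0
  show ?case by simp
next
  case (Suc j)
  have "finite (set_pmf (indep_prod_pmf j D))" "finite (set_pmf (D j))"
    using Suc.prems finite_set_indep_prod[of j D] by auto
  then show ?case
    using Suc by (simp add: expectation_bind_finite power_mult_distrib mult.commute)
qed

lemma indep_prod_pos:
  assumes "\<And>i x. i < j \<Longrightarrow> x \<in> set_pmf (D i) \<Longrightarrow> 0 < x" "x \<in> set_pmf (indep_prod_pmf j D)"
  shows "0 < x"
  using assms
proof (induction j arbitrary: x)
  case (Suc j)
  then obtain y z where "y \<in> set_pmf (D j)" "z \<in> set_pmf (indep_prod_pmf j D)" "x = y * z"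
    by auto
  moreover from this have "0 < y" "0 < z"
    using Suc by (meson lessI, meson less_SucI)
  ultimately show ?case by simp
qed simp

text \<open>Passage from L2 to L1: \<open>mean\<close> and \<open>sq\<close> together say that the
  relative variance is at most \<open>\<delta>\<^sup>2\<close>.\<close>

lemma expectation_relative_error_le:
  fixes D :: "real pmf"
  assumes fin: "finite (set_pmf D)" and T: "T > 0" and \<delta>: "\<delta> > 0"
    and mean: "measure_pmf.expectation D (\<lambda>x. x) = T"
    and sq: "measure_pmf.expectation D (\<lambda>x. x\<^sup>2) \<le> T\<^sup>2 * (1 + \<delta>\<^sup>2)"
  shows "measure_pmf.expectation D (\<lambda>x. \<bar>x / T - 1\<bar>) \<le> \<delta>"
proof -
  let ?E = "measure_pmf.expectation D"
  note [simp] = fin integrable_measure_pmf_finite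
  \<comment> \<open>AM-GM: \<open>\<bar>y\<bar> \<le> (y\<^sup>2 / \<delta> + \<delta>) / 2\<close>, in place of Jensen's inequality\<close>
  have amgm: "\<bar>y\<bar> \<le> y\<^sup>2 / (2 * \<delta>) + \<delta> / 2" for y :: real
  proof -
    have "0 \<le> (\<bar>y\<bar> - \<delta>)\<^sup>2" by simp
    then have "2 * \<delta> * \<bar>y\<bar> \<le> y\<^sup>2 + \<delta>\<^sup>2"
      by (simp add: power2_diff algebra_simps)
    then show ?thesis
      using \<delta> by (simp add: field_simps power2_eq_square)
  qed
  have "?E (\<lambda>x. \<bar>x / T - 1\<bar>) \<le> ?E (\<lambda>x. x\<^sup>2 / (2 * \<delta> * T\<^sup>2) - x / (\<delta> * T) + (1 / (2 * \<delta>) + \<delta> / 2))"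
  proof (rule expectation_mono_finite)
    fix x
    have "(x / T - 1)\<^sup>2 / (2 * \<delta>) = x\<^sup>2 / (2 * \<delta> * T\<^sup>2) - x / (\<delta> * T) + 1 / (2 * \<delta>)"
      using T \<delta> by (simp add: power2_eq_square field_simps)
    then show "\<bar>x / T - 1\<bar> \<le> x\<^sup>2 / (2 * \<delta> * T\<^sup>2) - x / (\<delta> * T) + (1 / (2 * \<delta>) + \<delta> / 2)"
      using amgm[of "x / T - 1"] by simp
  qed simp
  also have "\<dots> = ?E (\<lambda>x. x\<^sup>2) / (2 * \<delta> * T\<^sup>2) - T / (\<delta> * T) + (1 / (2 * \<delta>) + \<delta> / 2)"
    by (simp add: mean)
  also have "\<dots> \<le> T\<^sup>2 * (1 + \<delta>\<^sup>2) / (2 * \<delta> * T\<^sup>2) - T / (\<delta> * T) + (1 / (2 * \<delta>) + \<delta> / 2)"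
    using divide_right_mono[OF sq, of "2 * \<delta> * T\<^sup>2"] \<delta> by simp
  also have "\<dots> = \<delta>"
    using T \<delta> by (simp add: field_simps power2_eq_square)
  finally show ?thesis .
qed

subsection \<open>Chain rule and tamed marginals\<close>

text \<open>Fixes the first \<open>i\<close> bits to those of \<open>w\<close>. At
  \<open>i = 0\<close> it is the all-star query, which asks for an unconditioned sample.\<close>

definition prefix_query :: "nat \<Rightarrow> bool list \<Rightarrow> nat \<Rightarrow> bool option list" where
  "prefix_query n w i = map (\<lambda>j. if j < i then Some (w ! j) else None) [0..<n]"

text \<open>Defined from the oracle and not from the distribution, so it has a value even after a
  prefix of mass zero, namely whatever the oracle answers there.\<close>

definition marginal :: "nat \<Rightarrow> subcond \<Rightarrow> bool list \<Rightarrow> nat \<Rightarrow> real" where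
  "marginal n orc w i = measure_pmf.prob (orc (prefix_query n w i)) {v. v ! i = w ! i}"

text \<open>Mixture of the marginal with a fair coin. For \<eta> in \<open>(0, 1]\<close> it is at
  least \<open>\<eta> / 2\<close>, so relative errors make sense even where the marginal
  vanishes.\<close>

definition tamed :: "real \<Rightarrow> nat \<Rightarrow> subcond \<Rightarrow> bool list \<Rightarrow> nat \<Rightarrow> real" where
  "tamed \<eta> n orc w i = (1 - \<eta>) * marginal n orc w i + \<eta> / 2"

lemma length_prefix_query [simp]: "length (prefix_query n w i) = n"
  by (simp add: prefix_query_def)

lemma subcube_prefix_query:
  "i \<le> n \<Longrightarrow> subcube n (prefix_query n w i) = {v \<in> bitstrings n. \<forall>j<i. v ! j = w ! j}"
  by (auto simp: subcube_def prefix_query_def)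

lemma prefix_query_append:
  "i \<le> length u \<Longrightarrow> prefix_query n (u @ v) i = prefix_query n u i"
  by (simp add: prefix_query_def nth_append cong: if_cong)

lemma marginal_append:
  "i < length u \<Longrightarrow> marginal n orc (u @ v) i = marginal n orc u i"
  by (simp add: marginal_def prefix_query_append nth_append)

text \<open>The two strings share their first \<open>length u\<close> bits and hence the query, so
  the two events are complementary under one and the same answer distribution.\<close>

lemma marginal_sum_bits:
  "marginal n orc (u @ [True]) (length u) + marginal n orc (u @ [False]) (length u) = 1"
proof -
  let ?M = "orc (prefix_query n u (length u))"
  have "{v. \<not> v ! length u} = UNIV - {v. v ! length u}" by auto
  then have "measure_pmf.prob ?M {v. \<not> v ! length u} = 1 - measure_pmf.prob ?M {v. v ! length u}"
    using measure_pmf.prob_compl[of "{v. v ! length u}" ?M] by simp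
  then show ?thesis
    by (simp add: marginal_def prefix_query_append)
qed

lemma marginal_bounds: "0 \<le> marginal n orc w i" "marginal n orc w i \<le> 1"
  by (simp_all add: marginal_def)

section \<open>Sums over the cube\<close>

lemma finite_bitstrings [simp]: "finite (bitstrings n)"
  using finite_lists_length_eq[of "UNIV :: bool set" n] by (simp add: bitstrings_def)

lemma bitstrings_0: "bitstrings 0 = {[]}"
  by (auto simp: bitstrings_def)

text \<open>The last bit is split off rather than the first, because a marginal depends on the
  prefix before its bit.\<close>

lemma sum_bitstrings_Suc:
  "(\<Sum>w\<in>bitstrings (Suc j). f w) = (\<Sum>u\<in>bitstrings j. f (u @ [True]) + f (u @ [False]))"
proof -
  have "bij_betw (\<lambda>(u, b). u @ [b]) (bitstrings j \<times> (UNIV :: bool set)) (bitstrings (Suc j))"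
  proof (rule bij_betwI[where g = "\<lambda>w. (butlast w, last w)"])
    show "(\<lambda>w. (butlast w, last w)) \<in> bitstrings (Suc j) \<rightarrow> bitstrings j \<times> (UNIV :: bool set)"
      by (auto simp: bitstrings_def)
    show "(\<lambda>(u, b). u @ [b]) (butlast w, last w) = w" if "w \<in> bitstrings (Suc j)" for w
      using that by (cases w rule: rev_cases) (auto simp: bitstrings_def)
  qed (auto simp: bitstrings_def)
  then have "(\<Sum>w\<in>bitstrings (Suc j). f w) = (\<Sum>(u, b)\<in>bitstrings j \<times> UNIV. f (u @ [b]))"
    by (simp add: sum.reindex_bij_betw[symmetric] case_prod_unfold)
  also have "\<dots> = (\<Sum>u\<in>bitstrings j. \<Sum>b\<in>UNIV. f (u @ [b]))"
    by (simp add: sum.cartesian_product)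
  finally show ?thesis by (simp add: UNIV_bool add.commute)
qed

text \<open>Summing out the last bit removes the last factor, since its two tamed values add up to
  \<open>(1 - \<eta>) + \<eta>\<close>.\<close>

lemma sum_prod_tamed: "(\<Sum>w\<in>bitstrings j. \<Prod>i<j. tamed \<eta> n orc w i) = 1"
proof (induction j)
  case 0
  show ?case by (simp add: bitstrings_0)
next
  case (Suc j)
  have "(\<Prod>i<Suc j. tamed \<eta> n orc (u @ [True]) i) + (\<Prod>i<Suc j. tamed \<eta> n orc (u @ [False]) i)
      = (\<Prod>i<j. tamed \<eta> n orc u i)" if u: "u \<in> bitstrings j" for u
  proof -
    have len: "length u = j" using u by (simp add: bitstrings_def)
    have "tamed \<eta> n orc (u @ [True]) j + tamed \<eta> n orc (u @ [False]) j =
        (1 - \<eta>) * (marginal n orc (u @ [True]) (length u) + marginal n orc (u @ [False]) (length u)) + \<eta>"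
      by (simp add: tamed_def len algebra_simps)
    then have "tamed \<eta> n orc (u @ [True]) j + tamed \<eta> n orc (u @ [False]) j = 1"
      by (simp only: marginal_sum_bits) simp
    moreover have "(\<Prod>i<j. tamed \<eta> n orc (u @ [b]) i) = (\<Prod>i<j. tamed \<eta> n orc u i)" for b
      by (intro prod.cong) (auto simp: tamed_def marginal_append len)
    ultimately show ?thesis by (simp flip: distrib_left)
  qed
  then show ?case
    unfolding sum_bitstrings_Suc using Suc.IH by (simp cong: sum.cong)
qed

text \<open>Chain rule: fixing ever longer prefixes of \<open>w\<close> shrinks the whole cube to
  \<open>{w}\<close>, and each marginal is the ratio of two successive masses as long as the larger
  one is positive.\<close>

lemma pmf_eq_prod_marginal:
  assumes D: "distr_on_cube n D" and orc: "subcond_oracle n D orc" and w: "w \<in> bitstrings n"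
  shows "pmf D w = (\<Prod>i<n. marginal n orc w i)"
proof -
  let ?C = "\<lambda>i. subcube n (prefix_query n w i)"
  have "measure_pmf.prob D (?C j) = (\<Prod>i<j. marginal n orc w i)" if "j \<le> n" for j
    using that
  proof (induction j)
    case 0
    have "measure_pmf.prob D (bitstrings n) = 1"
      using D by (simp add: distr_on_cube_def measure_pmf.prob_eq_1 AE_measure_pmf_iff subset_iff)
    then show ?case by (simp add: subcube_prefix_query)
  next
    case (Suc j)
    have split: "?C (Suc j) = ?C j \<inter> {v. v ! j = w ! j}"
      using Suc.prems by (auto simp: subcube_prefix_query less_Suc_eq)
    have "measure_pmf.prob D (?C (Suc j)) = measure_pmf.prob D (?C j) * marginal n orc w j"
    proof (cases "measure_pmf.prob D (?C j) > 0")
      case True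
      then have "set_pmf D \<inter> ?C j \<noteq> {}"
        by (metis less_irrefl measure_pmf_zero_iff)
      moreover have "orc (prefix_query n w j) = cond_pmf D (?C j)"
        using orc True by (simp add: subcond_oracle_def)
      ultimately have "marginal n orc w j = measure_pmf.prob D (?C (Suc j)) / measure_pmf.prob D (?C j)"
        using True
        by (simp add: marginal_def cond_pmf.rep_eq measure_uniform_measure
            measure_pmf.emeasure_eq_measure split)
      then show ?thesis using True by simp
    next
      \<comment> \<open>The oracle may answer anything here, but the smaller subcube inherits mass
        zero, so both sides are zero.\<close>
      case False
      then have 0: "measure_pmf.prob D (?C j) = 0"
        using measure_nonneg[of D "?C j"] by linarith
      moreover have "measure_pmf.prob D (?C (Suc j)) \<le> measure_pmf.prob D (?C j)"
        unfolding split by (intro measure_pmf.finite_measure_mono) auto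
      ultimately show ?thesis
        using measure_nonneg[of D "?C (Suc j)"] by simp
    qed
    then show ?case using Suc by simp
  qed
  moreover have "?C n = {w}"
    using w by (auto simp: subcube_prefix_query bitstrings_def intro: nth_equalityI)
  ultimately show ?thesis
    by (metis order_refl measure_pmf_single)
qed

text \<open>Dropping \<open>\<eta> / 2\<close> from each factor leaves
  \<open>(1 - \<eta>) ^ n * pmf D w\<close>, and Bernoulli's inequality finishes.\<close>

lemma tamed_lower_bound:
  assumes "0 \<le> \<eta>" "\<eta> \<le> 1" "distr_on_cube n D" "subcond_oracle n D orc" "w \<in> bitstrings n"
  shows "(1 - n * \<eta>) * pmf D w \<le> (\<Prod>i<n. tamed \<eta> n orc w i)"
proof -
  have "(1 - n * \<eta>) * pmf D w \<le> (1 - \<eta>) ^ n * pmf D w"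
    using Bernoulli_inequality[of "- \<eta>" n] assms by (intro mult_right_mono) auto
  also have "\<dots> = (\<Prod>i<n. (1 - \<eta>) * marginal n orc w i)"
    using assms by (simp add: pmf_eq_prod_marginal prod.distrib)
  also have "\<dots> \<le> (\<Prod>i<n. tamed \<eta> n orc w i)"
    using assms by (intro prod_mono) (auto simp: tamed_def marginal_bounds)
  finally show ?thesis .
qed

text \<open>A one-sided bound suffices because both functions have total mass one: if
  \<open>x \<ge> - c\<close> and \<open>c \<ge> 0\<close> then
  \<open>\<bar>x\<bar> \<le> x + 2 * c\<close>, and the signed differences \<open>x\<close> cancel
  on summation. Here \<open>c = n * \<eta> * pmf D w\<close>.\<close>

lemma sum_abs_tamed_diff:
  assumes "0 \<le> \<eta>" "\<eta> \<le> 1" "distr_on_cube n D" "subcond_oracle n D orc"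
  shows "(\<Sum>w\<in>bitstrings n. \<bar>(\<Prod>i<n. tamed \<eta> n orc w i) - pmf D w\<bar>) \<le> 2 * n * \<eta>"
proof -
  let ?T = "\<lambda>w. \<Prod>i<n. tamed \<eta> n orc w i"
  have total: "(\<Sum>w\<in>bitstrings n. pmf D w) = 1"
    using assms by (intro sum_pmf_eq_1) (auto simp: distr_on_cube_def)
  have "(\<Sum>w\<in>bitstrings n. \<bar>?T w - pmf D w\<bar>) \<le>
      (\<Sum>w\<in>bitstrings n. (?T w - pmf D w) + 2 * real n * \<eta> * pmf D w)"
  proof (rule sum_mono)
    fix w assume "w \<in> bitstrings n"
    then have "(1 - n * \<eta>) * pmf D w \<le> ?T w"
      using assms tamed_lower_bound by blast
    moreover have "0 \<le> n * \<eta> * pmf D w"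
      using assms by simp
    ultimately show "\<bar>?T w - pmf D w\<bar> \<le> (?T w - pmf D w) + 2 * real n * \<eta> * pmf D w"
      by (simp add: algebra_simps abs_le_iff)
  qed
  also have "\<dots> = 2 * real n * \<eta>"
    by (simp add: sum.distrib sum_subtractf sum_prod_tamed total flip: sum_distrib_left)
  finally show ?thesis .
qed

subsection \<open>Density estimates\<close>

text \<open>Agreement with \<open>w ! i\<close> is recorded rather than the bit itself, so the mean
  is the chain-rule factor of \<open>w\<close>.\<close>

definition bit_pmf :: "nat \<Rightarrow> subcond \<Rightarrow> bool list \<Rightarrow> nat \<Rightarrow> real pmf" where
  "bit_pmf n orc w i = map_pmf (\<lambda>v. of_bool (v ! i = w ! i)) (orc (prefix_query n w i))"

text \<open>Taming is affine, so applied to an empirical frequency it gives an unbiased estimate of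
  \<open>tamed\<close>.\<close>

definition tamed_estimate :: "nat \<Rightarrow> real \<Rightarrow> nat \<Rightarrow> subcond \<Rightarrow> bool list \<Rightarrow> nat \<Rightarrow> real pmf" where
  "tamed_estimate N \<eta> n orc w i =
     map_pmf (\<lambda>s. (1 - \<eta>) * (s / N) + \<eta> / 2) (sum_pmf N (bit_pmf n orc w i))"

definition density_estimate :: "nat \<Rightarrow> real \<Rightarrow> nat \<Rightarrow> subcond \<Rightarrow> bool list \<Rightarrow> real pmf" where
  "density_estimate N \<eta> n orc w = indep_prod_pmf n (tamed_estimate N \<eta> n orc w)"

lemma set_bit_pmf: "set_pmf (bit_pmf n orc w i) \<subseteq> {0, 1}"
  by (auto simp: bit_pmf_def)

lemma finite_set_bit_pmf [simp]: "finite (set_pmf (bit_pmf n orc w i))"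
  by (rule finite_subset[OF set_bit_pmf]) simp

lemma bit_pmf_expectation:
  "measure_pmf.expectation (bit_pmf n orc w i) (\<lambda>x. x) = marginal n orc w i"
proof -
  have "(\<lambda>v. of_bool (v ! i = w ! i)) = (indicator {v. v ! i = w ! i} :: _ \<Rightarrow> real)"
    by (auto simp: indicator_def)
  then show ?thesis
    by (simp add: bit_pmf_def marginal_def)
qed

lemma bit_pmf_variance:
  fixes n orc w i
  defines "q \<equiv> marginal n orc w i"
  shows "measure_pmf.expectation (bit_pmf n orc w i) (\<lambda>x. (x - q)\<^sup>2) = q * (1 - q)"
proof -
  let ?E = "measure_pmf.expectation (bit_pmf n orc w i)"
  \<comment> \<open>On \<open>{0, 1}\<close> every number equals its square, which makes the
    integrand affine.\<close>
  have "?E (\<lambda>x. (x - q)\<^sup>2) = ?E (\<lambda>x. (1 - 2 * q) * x + q\<^sup>2)"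
    using set_bit_pmf[of n orc w i]
    by (intro integral_cong_AE) (auto simp: AE_measure_pmf_iff power2_eq_square algebra_simps)
  also have "\<dots> = (1 - 2 * q) * ?E (\<lambda>x. x) + q\<^sup>2"
    by (simp add: integrable_measure_pmf_finite)
  finally show ?thesis
    by (simp add: bit_pmf_expectation q_def[symmetric] power2_eq_square algebra_simps)
qed

lemma sum_pmf_nonneg:
  "(\<And>x. x \<in> set_pmf D \<Longrightarrow> 0 \<le> x) \<Longrightarrow> s \<in> set_pmf (sum_pmf N D) \<Longrightarrow> 0 \<le> s"
  by (induction N arbitrary: s) auto

lemma finite_set_tamed_estimate [simp]: "finite (set_pmf (tamed_estimate N \<eta> n orc w i))"
  by (simp add: tamed_estimate_def finite_set_sum_pmf)

lemma finite_set_density_estimate [simp]: "finite (set_pmf (density_estimate N \<eta> n orc w))"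
  by (simp add: density_estimate_def finite_set_indep_prod)

lemma tamed_estimate_pos:
  assumes "0 < \<eta>" "\<eta> \<le> 1" "x \<in> set_pmf (tamed_estimate N \<eta> n orc w i)"
  shows "0 < x"
proof -
  obtain s where s: "s \<in> set_pmf (sum_pmf N (bit_pmf n orc w i))"
    and x: "x = (1 - \<eta>) * (s / N) + \<eta> / 2"
    using assms(3) by (auto simp: tamed_estimate_def)
  have "0 \<le> s"
    using s set_bit_pmf[of n orc w i] by (intro sum_pmf_nonneg[OF _ s]) auto
  then have "0 \<le> (1 - \<eta>) * (s / N)"
    using assms(2) by simp
  then show ?thesis using assms(1) x by simp
qed

lemma density_estimate_pos:
  assumes "0 < \<eta>" "\<eta> \<le> 1" "x \<in> set_pmf (density_estimate N \<eta> n orc w)"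
  shows "0 < x"
  using indep_prod_pos[of n "tamed_estimate N \<eta> n orc w" x] tamed_estimate_pos[OF assms(1,2)] assms(3)
  by (auto simp: density_estimate_def)

text \<open>With \<open>r\<close> the tamed marginal, the variance is
  \<open>(1 - \<eta>)\<^sup>2 * q * (1 - q) / N\<close>, at most \<open>r / N\<close>, and
  \<open>r \<ge> \<eta> / 2\<close> makes this a relative variance of at most
  \<open>2 / (\<eta> * N)\<close>.\<close>

lemma tamed_estimate_moments:
  assumes \<eta>: "0 < \<eta>" "\<eta> \<le> 1" and N: "N > 0"
  shows "measure_pmf.expectation (tamed_estimate N \<eta> n orc w i) (\<lambda>x. x) = tamed \<eta> n orc w i"
    and "measure_pmf.expectation (tamed_estimate N \<eta> n orc w i) (\<lambda>x. x\<^sup>2) \<le>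
      (tamed \<eta> n orc w i)\<^sup>2 * (1 + 2 / (\<eta> * N))"
proof -
  let ?S = "sum_pmf N (bit_pmf n orc w i)"
  let ?E = "measure_pmf.expectation ?S"
  define q where "q = marginal n orc w i"
  define r where "r = tamed \<eta> n orc w i"
  note [simp] = finite_set_sum_pmf integrable_measure_pmf_finite
  have q: "0 \<le> q" "q \<le> 1" by (simp_all add: q_def marginal_bounds)
  have rq: "r = (1 - \<eta>) * q + \<eta> / 2" by (simp add: r_def q_def tamed_def)
  have ES: "?E (\<lambda>s. s) = N * q"
    by (simp add: sum_pmf_expectation bit_pmf_expectation q_def)
  have VS: "?E (\<lambda>s. (s - N * q)\<^sup>2) = N * (q * (1 - q))"
    using sum_pmf_variance[of "bit_pmf n orc w i" N]
    by (simp add: bit_pmf_expectation bit_pmf_variance q_def)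
  show "measure_pmf.expectation (tamed_estimate N \<eta> n orc w i) (\<lambda>x. x) = tamed \<eta> n orc w i"
    using N by (simp add: tamed_estimate_def ES flip: r_def) (simp add: rq)
  have "measure_pmf.expectation (tamed_estimate N \<eta> n orc w i) (\<lambda>x. x\<^sup>2) =
      ?E (\<lambda>s. ((1 - \<eta>) * (s / N) + \<eta> / 2)\<^sup>2)"
    by (simp add: tamed_estimate_def)
  \<comment> \<open>The estimate is \<open>z + r\<close> with \<open>z\<close> a multiple of the
    centred sum. Expanding its square leaves only the two known moments \<open>VS\<close> and
    \<open>ES\<close>.\<close>
  also have "\<dots> = ?E (\<lambda>s. ((1 - \<eta>) / N)\<^sup>2 * (s - N * q)\<^sup>2 +
      (2 * r * (1 - \<eta>) / N * s + (r\<^sup>2 - 2 * r * (1 - \<eta>) * q)))"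
  proof (intro arg_cong[where f = ?E] ext)
    fix s :: real
    define z where "z = (1 - \<eta>) / N * (s - N * q)"
    have 1: "(1 - \<eta>) * (s / N) + \<eta> / 2 = z + r"
      using N by (simp add: z_def rq field_simps)
    have 2: "2 * r * (1 - \<eta>) / N * s + (r\<^sup>2 - 2 * r * (1 - \<eta>) * q) = 2 * r * z + r\<^sup>2"
      using N by (simp add: z_def field_simps)
    show "((1 - \<eta>) * (s / N) + \<eta> / 2)\<^sup>2 =
        ((1 - \<eta>) / N)\<^sup>2 * (s - N * q)\<^sup>2 + (2 * r * (1 - \<eta>) / N * s + (r\<^sup>2 - 2 * r * (1 - \<eta>) * q))"
      unfolding 1 2 by (simp add: power2_sum z_def power_mult_distrib power_divide)
  qed
  also have "\<dots> = ((1 - \<eta>) / N)\<^sup>2 * ?E (\<lambda>s. (s - N * q)\<^sup>2) +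
      (2 * r * (1 - \<eta>) / N * ?E (\<lambda>s. s) + (r\<^sup>2 - 2 * r * (1 - \<eta>) * q))"
    by simp
  also have "\<dots> = (1 - \<eta>)\<^sup>2 * (q * (1 - q)) / N + r\<^sup>2"
    unfolding ES VS using N by (simp add: power2_eq_square field_simps)
  also have "\<dots> \<le> r\<^sup>2 * (1 + 2 / (\<eta> * N))"
  proof -
    have "(1 - \<eta>)\<^sup>2 * (q * (1 - q)) = ((1 - \<eta>) * (1 - q)) * ((1 - \<eta>) * q)"
      by (simp add: power2_eq_square)
    also have "\<dots> \<le> 1 * r"
      using \<eta> q by (intro mult_mono mult_le_one) (auto simp: rq)
    \<comment> \<open>The floor \<open>r \<ge> \<eta> / 2\<close> supplies the second factor
      \<open>r\<close> that a relative bound needs.\<close>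
    also have "\<dots> \<le> r * (r * 2 / \<eta>)"
    proof -
      have "0 \<le> (1 - \<eta>) * q" using \<eta> q by simp
      then have "0 \<le> r" "1 \<le> r * 2 / \<eta>"
        using \<eta> by (simp_all add: rq le_divide_eq)
      then show ?thesis using mult_left_mono[of 1 "r * 2 / \<eta>" r] by simp
    qed
    finally have "(1 - \<eta>)\<^sup>2 * (q * (1 - q)) / N \<le> r * (r * 2 / \<eta>) / N"
      by (intro divide_right_mono) auto
    also have "\<dots> = r\<^sup>2 * (2 / (\<eta> * N))"
      by (simp add: power2_eq_square)
    finally show ?thesis by (simp add: distrib_left)
  qed
  finally show "measure_pmf.expectation (tamed_estimate N \<eta> n orc w i) (\<lambda>x. x\<^sup>2) \<le>
      (tamed \<eta> n orc w i)\<^sup>2 * (1 + 2 / (\<eta> * N))"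
    by (simp add: r_def)
qed

lemma tamed_pos: "0 < \<eta> \<Longrightarrow> \<eta> \<le> 1 \<Longrightarrow> 0 < tamed \<eta> n orc w i"
  by (simp add: tamed_def add_nonneg_pos marginal_bounds)

text \<open>Relative second moments multiply over independent factors, which gives
  \<open>(1 + 2 / (\<eta> * N)) ^ n\<close>. The assumption \<open>pow\<close> is the demand on
  \<open>N\<close>, kept abstract until the parameters are chosen.\<close>

lemma density_estimate_error:
  assumes \<eta>: "0 < \<eta>" "\<eta> \<le> 1" and N: "N > 0" and \<delta>: "\<delta> > 0"
    and pow: "(1 + 2 / (\<eta> * N)) ^ n \<le> 1 + \<delta>\<^sup>2"
  shows "measure_pmf.expectation (density_estimate N \<eta> n orc w)
    (\<lambda>x. \<bar>x / (\<Prod>i<n. tamed \<eta> n orc w i) - 1\<bar>) \<le> \<delta>"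
proof (rule expectation_relative_error_le)
  let ?T = "\<Prod>i<n. tamed \<eta> n orc w i"
  show "0 < ?T"
    using \<eta> by (intro prod_pos) (auto simp: tamed_pos)
  show "measure_pmf.expectation (density_estimate N \<eta> n orc w) (\<lambda>x. x) = ?T"
    using indep_prod_expectation_power[of n "tamed_estimate N \<eta> n orc w" 1] assms
    by (simp add: density_estimate_def tamed_estimate_moments)
  have "measure_pmf.expectation (density_estimate N \<eta> n orc w) (\<lambda>x. x\<^sup>2) =
      (\<Prod>i<n. measure_pmf.expectation (tamed_estimate N \<eta> n orc w i) (\<lambda>x. x\<^sup>2))"
    by (simp add: density_estimate_def indep_prod_expectation_power)
  also have "\<dots> \<le> (\<Prod>i<n. (tamed \<eta> n orc w i)\<^sup>2 * (1 + 2 / (\<eta> * N)))"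
    using assms by (intro prod_mono) (auto simp: tamed_estimate_moments)
  also have "\<dots> = ?T\<^sup>2 * (1 + 2 / (\<eta> * N)) ^ n"
    by (simp add: prod.distrib prod_power_distrib)
  also have "\<dots> \<le> ?T\<^sup>2 * (1 + \<delta>\<^sup>2)"
    using pow by (intro mult_left_mono) auto
  finally show "measure_pmf.expectation (density_estimate N \<eta> n orc w) (\<lambda>x. x\<^sup>2) \<le> ?T\<^sup>2 * (1 + \<delta>\<^sup>2)" .
qed (use \<delta> in auto)

subsection \<open>The distance estimate from one sample\<close>

definition gap :: "real \<Rightarrow> real \<Rightarrow> real" where
  "gap a b = max 0 (1 - b / a)"

text \<open>As a function of \<open>b' / b\<close> the gap has slope at most \<open>b / a\<close> in
  absolute value. The cutoff at zero hides the ratios \<open>b / a > 1\<close>, where this slope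
  would be too large.\<close>

lemma gap_lipschitz_right:
  assumes "a > 0" "b > 0" "b' > 0"
  shows "\<bar>gap a b' - gap a b\<bar> \<le> \<bar>b' / b - 1\<bar>"
proof -
  define t y where "t = b / a" and "y = b' / b"
  have t: "t > 0" "y > 0" "b' / a = t * y" using assms by (auto simp: t_def y_def)
  have "\<bar>max 0 (1 - t * y) - max 0 (1 - t)\<bar> \<le> \<bar>y - 1\<bar>"
  proof (cases "t \<le> 1")
    case True
    have "\<bar>t * y - t\<bar> = t * \<bar>y - 1\<bar>"
      using t(1) abs_mult[of t "y - 1"] by (simp add: right_diff_distrib)
    also have "\<dots> \<le> \<bar>y - 1\<bar>"
      using True t by (intro mult_left_le_one_le) auto
    finally show ?thesis by (simp add: max_def abs_if split: if_splits)
  next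
    \<comment> \<open>Here \<open>gap a b = 0\<close>, and \<open>t * y \<ge> y\<close> bounds the
      other value by \<open>max 0 (1 - y)\<close>.\<close>
    case False
    then have "y \<le> t * y" using t by simp
    then show ?thesis using False by (simp add: max_def abs_if split: if_splits)
  qed
  then show ?thesis
    by (simp add: gap_def t(3) flip: t_def y_def)
qed

text \<open>The gap depends only on the ratio, so changing \<open>a\<close> has the effect of
  rescaling \<open>b\<close>. The error comes out relative to \<open>a\<close>, so \<open>a'\<close>
  can be the estimate.\<close>

lemma gap_lipschitz_left:
  assumes "a > 0" "a' > 0" "b > 0"
  shows "\<bar>gap a' b - gap a b\<bar> \<le> \<bar>a' / a - 1\<bar>"
proof -
  have "gap a b = gap a' (b * (a' / a))"
    using assms by (simp add: gap_def)
  moreover have "\<bar>gap a' (b * (a' / a)) - gap a' b\<bar> \<le> \<bar>b * (a' / a) / b - 1\<bar>"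
    using assms by (intro gap_lipschitz_right) auto
  ultimately show ?thesis using assms by (simp add: abs_minus_commute)
qed

lemma mult_gap: "a > 0 \<Longrightarrow> a * gap a b = max 0 (a - b)"
  by (auto simp: gap_def max_def field_simps)

lemma gap_bounds: "a > 0 \<Longrightarrow> b \<ge> 0 \<Longrightarrow> 0 \<le> gap a b \<and> gap a b \<le> 1"
  by (auto simp: gap_def)

text \<open>Uses \<open>\<bar>x\<bar> = 2 * max 0 x - x\<close>; the differences \<open>x\<close>
  sum to zero because both masses are one.\<close>

lemma d_TV_eq_sum_max:
  assumes "distr_on_cube n P" "distr_on_cube n Q"
  shows "d_TV n P Q = (\<Sum>w\<in>bitstrings n. max 0 (pmf P w - pmf Q w))"
proof -
  have total: "(\<Sum>w\<in>bitstrings n. pmf D w) = 1" if "distr_on_cube n D" for D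
    using that by (intro sum_pmf_eq_1) (auto simp: distr_on_cube_def)
  have "(\<Sum>w\<in>bitstrings n. \<bar>pmf P w - pmf Q w\<bar>) =
      (\<Sum>w\<in>bitstrings n. 2 * max 0 (pmf P w - pmf Q w) - (pmf P w - pmf Q w))"
    by (intro sum.cong) (auto simp: max_def)
  also have "\<dots> = 2 * (\<Sum>w\<in>bitstrings n. max 0 (pmf P w - pmf Q w))"
    using total assms by (simp add: sum_subtractf flip: sum_distrib_left)
  finally show ?thesis by (simp add: d_TV_def)
qed

section \<open>Bias of a single distance estimate\<close>

definition gap_pmf :: "nat \<Rightarrow> real \<Rightarrow> nat \<Rightarrow> bool list pmf \<Rightarrow> subcond \<Rightarrow> subcond \<Rightarrow> real pmf" where
  "gap_pmf N \<eta> n P OP OQ =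
     bind_pmf P (\<lambda>w. bind_pmf (density_estimate N \<eta> n OP w) (\<lambda>a.
       map_pmf (gap a) (density_estimate N \<eta> n OQ w)))"


lemma finite_set_gap_pmf: "distr_on_cube n P \<Longrightarrow> finite (set_pmf (gap_pmf N \<eta> n P OP OQ))"
  unfolding distr_on_cube_def gap_pmf_def using finite_subset[OF _ finite_bitstrings[of n]] by auto

lemma set_gap_pmf:
  assumes "0 < \<eta>" "\<eta> \<le> 1" "z \<in> set_pmf (gap_pmf N \<eta> n P OP OQ)"
  shows "0 \<le> z" "z \<le> 1"
proof -
  obtain w a b where "z = gap a b" "a \<in> set_pmf (density_estimate N \<eta> n OP w)"
      "b \<in> set_pmf (density_estimate N \<eta> n OQ w)"
    using assms(3) by (auto simp: gap_pmf_def)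
  then show "0 \<le> z" "z \<le> 1"
    using density_estimate_pos[OF assms(1,2)] gap_bounds by (auto simp: less_imp_le)
qed

lemma expectation_gap_density_estimates:
  fixes N n \<eta> OP OQ w
  defines "A \<equiv> density_estimate N \<eta> n OP w" and "B \<equiv> density_estimate N \<eta> n OQ w"
    and "TA \<equiv> \<Prod>i<n. tamed \<eta> n OP w i" and "TB \<equiv> \<Prod>i<n. tamed \<eta> n OQ w i"
  assumes \<eta>: "0 < \<eta>" "\<eta> \<le> 1" and N: "N > 0" and \<delta>: "\<delta> > 0"
    and pow: "(1 + 2 / (\<eta> * N)) ^ n \<le> 1 + \<delta>\<^sup>2"
  shows "\<bar>measure_pmf.expectation A (\<lambda>a. measure_pmf.expectation B (gap a)) - gap TA TB\<bar> \<le> 2 * \<delta>"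
proof -
  let ?A = "measure_pmf.expectation A" and ?B = "measure_pmf.expectation B"
  have fin [simp]: "finite (set_pmf A)" "finite (set_pmf B)"
    by (simp_all add: A_def B_def)
  note [simp] = integrable_measure_pmf_finite
  have T: "TA > 0" "TB > 0"
    using \<eta> by (auto simp: TA_def TB_def tamed_pos intro!: prod_pos)
  have pos: "a \<in> set_pmf A \<Longrightarrow> a > 0" "b \<in> set_pmf B \<Longrightarrow> b > 0" for a b
    using density_estimate_pos[OF \<eta>] by (auto simp: A_def B_def)
  have err: "?A (\<lambda>a. \<bar>a / TA - 1\<bar>) \<le> \<delta>" "?B (\<lambda>b. \<bar>b / TB - 1\<bar>) \<le> \<delta>"
    using density_estimate_error[OF \<eta> N \<delta> pow] by (simp_all add: A_def B_def TA_def TB_def)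
  have "\<bar>?A (\<lambda>a. ?B (gap a)) - gap TA TB\<bar> = \<bar>?A (\<lambda>a. ?B (\<lambda>b. gap a b - gap TA TB))\<bar>"
    by simp
  also have "\<dots> \<le> ?A (\<lambda>a. \<bar>?B (\<lambda>b. gap a b - gap TA TB)\<bar>)"
    by (rule integral_abs_bound)
  also have "\<dots> \<le> ?A (\<lambda>a. ?B (\<lambda>b. \<bar>gap a b - gap TA TB\<bar>))"
    by (intro expectation_mono_finite integral_abs_bound) simp
  also have "\<dots> \<le> ?A (\<lambda>a. ?B (\<lambda>b. \<bar>a / TA - 1\<bar> + \<bar>b / TB - 1\<bar>))"
  proof (intro expectation_mono_finite fin)
    fix a b assume "a \<in> set_pmf A" "b \<in> set_pmf B"
    then show "\<bar>gap a b - gap TA TB\<bar> \<le> \<bar>a / TA - 1\<bar> + \<bar>b / TB - 1\<bar>"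
      \<comment> \<open>The intermediate value is \<open>gap TA b\<close>: the two arguments are
        exchanged one at a time.\<close>
      using gap_lipschitz_left[of TA a b] gap_lipschitz_right[of TA TB b] pos T by fastforce
  qed
  also have "\<dots> = ?A (\<lambda>a. \<bar>a / TA - 1\<bar>) + ?B (\<lambda>b. \<bar>b / TB - 1\<bar>)"
    by simp
  finally show ?thesis using err by linarith
qed

text \<open>The estimates are replaced by the tamed products, then \<open>tp\<close> by
  \<open>p\<close>, then \<open>tq\<close> by \<open>q\<close>. Weighted by \<open>p\<close> and
  summed over the cube, the first exchange costs at most \<open>2 * \<delta>\<close> and each of the
  others at most \<open>2 * n * \<eta>\<close>.\<close>

lemma gap_pmf_expectation:
  assumes P: "distr_on_cube n P" and Q: "distr_on_cube n Q"
    and OP: "subcond_oracle n P OP" and OQ: "subcond_oracle n Q OQ"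
    and \<eta>: "0 < \<eta>" "\<eta> \<le> 1" and N: "N > 0" and \<delta>: "\<delta> > 0"
    and pow: "(1 + 2 / (\<eta> * N)) ^ n \<le> 1 + \<delta>\<^sup>2"
  shows "\<bar>measure_pmf.expectation (gap_pmf N \<eta> n P OP OQ) (\<lambda>z. z) - d_TV n P Q\<bar> \<le>
    2 * \<delta> + 4 * n * \<eta>"
proof -
  let ?TP = "\<lambda>w. \<Prod>i<n. tamed \<eta> n OP w i" and ?TQ = "\<lambda>w. \<Prod>i<n. tamed \<eta> n OQ w i"
  define g where "g w = measure_pmf.expectation (density_estimate N \<eta> n OP w)
    (\<lambda>a. measure_pmf.expectation (density_estimate N \<eta> n OQ w) (gap a))" for w
  have sub: "set_pmf P \<subseteq> bitstrings n" and finP: "finite (set_pmf P)"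
    using P finite_subset[OF _ finite_bitstrings] by (auto simp: distr_on_cube_def)
  have "measure_pmf.expectation (gap_pmf N \<eta> n P OP OQ) (\<lambda>z. z) = measure_pmf.expectation P g"
    using finP by (simp add: gap_pmf_def expectation_bind_finite g_def[abs_def])
  also have "\<dots> = (\<Sum>w\<in>bitstrings n. pmf P w * g w)"
    using sub by (subst integral_measure_pmf[of "bitstrings n"]) auto
  finally have "measure_pmf.expectation (gap_pmf N \<eta> n P OP OQ) (\<lambda>z. z) - d_TV n P Q =
      (\<Sum>w\<in>bitstrings n. pmf P w * g w - max 0 (pmf P w - pmf Q w))"
    by (simp add: d_TV_eq_sum_max[OF P Q] sum_subtractf)
  also have "\<bar>\<dots>\<bar> \<le> (\<Sum>w\<in>bitstrings n. \<bar>pmf P w * g w - max 0 (pmf P w - pmf Q w)\<bar>)"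
    by (rule sum_abs)
  also have "\<dots> \<le> (\<Sum>w\<in>bitstrings n. pmf P w * (2 * \<delta>) + \<bar>?TP w - pmf P w\<bar> + \<bar>?TQ w - pmf Q w\<bar>)"
  proof (rule sum_mono)
    fix w
    define p q tp tq where "p = pmf P w" "q = pmf Q w" "tp = ?TP w" "tq = ?TQ w"
    have t: "tp > 0" "tq > 0"
      using \<eta> by (auto simp: p_q_tp_tq_def tamed_pos intro!: prod_pos)
    have pq: "p \<ge> 0" "q \<ge> 0" by (simp_all add: p_q_tp_tq_def)
    have "\<bar>p * g w - max 0 (p - q)\<bar> \<le> p * (2 * \<delta>) + \<bar>tp - p\<bar> + \<bar>tq - q\<bar>"
    \<comment> \<open>Errors relative to \<open>p\<close> are meaningless at \<open>p = 0\<close>,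
      but such strings contribute zero on both sides.\<close>
    proof (cases "p = 0")
      case True
      then show ?thesis using pq by simp
    next
      case False
      then have p: "p > 0" using pq by simp
      have "\<bar>p * g w - p * gap tp tq\<bar> = p * \<bar>g w - gap tp tq\<bar>"
        using p by (simp add: abs_mult flip: right_diff_distrib)
      also have "\<dots> \<le> p * (2 * \<delta>)"
        using expectation_gap_density_estimates[OF \<eta> N \<delta> pow, of OP w OQ] p
        by (intro mult_left_mono) (auto simp: g_def p_q_tp_tq_def)
      finally have 1: "\<bar>p * g w - p * gap tp tq\<bar> \<le> p * (2 * \<delta>)" .
      \<comment> \<open>The weight \<open>p\<close> turns the relative error of \<open>tp\<close>
        into an absolute one, which is summable over the cube.\<close>
      have "\<bar>p * gap tp tq - p * gap p tq\<bar> = p * \<bar>gap tp tq - gap p tq\<bar>"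
        using p by (simp add: abs_mult flip: right_diff_distrib)
      also have "\<dots> \<le> p * \<bar>tp / p - 1\<bar>"
        using p t by (intro mult_left_mono gap_lipschitz_left) auto
      also have "\<dots> = \<bar>p * (tp / p - 1)\<bar>"
        using p by (simp add: abs_mult)
      also have "\<dots> = \<bar>tp - p\<bar>"
        using p by (simp add: right_diff_distrib)
      finally have 2: "\<bar>p * gap tp tq - p * gap p tq\<bar> \<le> \<bar>tp - p\<bar>" .
      have 3: "\<bar>p * gap p tq - max 0 (p - q)\<bar> \<le> \<bar>tq - q\<bar>"
        using p by (simp add: mult_gap)
      show ?thesis using 1 2 3 by linarith
    qed
    then show "\<bar>pmf P w * g w - max 0 (pmf P w - pmf Q w)\<bar> \<le>
        pmf P w * (2 * \<delta>) + \<bar>?TP w - pmf P w\<bar> + \<bar>?TQ w - pmf Q w\<bar>"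
      by (simp add: p_q_tp_tq_def)
  qed
  also have "\<dots> \<le> 2 * \<delta> + 2 * real n * \<eta> + 2 * real n * \<eta>"
  proof -
    have "(\<Sum>w\<in>bitstrings n. pmf P w) = 1"
      using sub by (intro sum_pmf_eq_1) auto
    then have "(\<Sum>w\<in>bitstrings n. pmf P w * (2 * \<delta>)) = 2 * \<delta>"
      by (simp flip: sum_distrib_right)
    then show ?thesis
      using sum_abs_tamed_diff[OF less_imp_le[OF \<eta>(1)] \<eta>(2) P OP]
        sum_abs_tamed_diff[OF less_imp_le[OF \<eta>(1)] \<eta>(2) Q OQ]
      unfolding sum.distrib by linarith
  qed
  finally show ?thesis by linarith
qed

text \<open>Values in \<open>[0, 1]\<close> deviate from their mean by at most one, so the sum has
  variance at most \<open>m\<close>. The indicator of the event is dominated by the scaled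
  square.\<close>

lemma sum_pmf_chebyshev:
  fixes D :: "real pmf" and m :: nat and t \<mu> :: real
  assumes fin: "finite (set_pmf D)" and D: "\<And>x. x \<in> set_pmf D \<Longrightarrow> 0 \<le> x \<and> x \<le> 1"
    and m: "m > 0" and t: "t > 0"
  defines "\<mu> \<equiv> measure_pmf.expectation D (\<lambda>x. x)"
  shows "measure_pmf.prob (sum_pmf m D) {s. \<bar>s - m * \<mu>\<bar> \<ge> m * t} \<le> 1 / (m * t\<^sup>2)"
proof -
  let ?D = "measure_pmf.expectation D" and ?S = "measure_pmf.expectation (sum_pmf m D)"
  have \<mu>: "0 \<le> \<mu>" "\<mu> \<le> 1"
    using expectation_mono_finite[OF fin, of "\<lambda>_. 0" "\<lambda>x. x"]
      expectation_mono_finite[OF fin, of "\<lambda>x. x" "\<lambda>_. 1"] D by (auto simp: \<mu>_def)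
  have "?D (\<lambda>x. (x - \<mu>)\<^sup>2) \<le> ?D (\<lambda>_. 1)"
  proof (rule expectation_mono_finite[OF fin])
    fix x assume "x \<in> set_pmf D"
    then show "(x - \<mu>)\<^sup>2 \<le> 1"
      using D[of x] \<mu> by (intro iffD2[OF abs_square_le_1]) linarith
  qed
  then have var: "?S (\<lambda>s. (s - m * \<mu>)\<^sup>2) \<le> m"
    using sum_pmf_variance[OF fin, of m] by (simp add: \<mu>_def mult_left_le)
  have mt: "m * t > 0" using m t by simp
  have "measure_pmf.prob (sum_pmf m D) {s. \<bar>s - m * \<mu>\<bar> \<ge> m * t} =
      ?S (indicator {s. \<bar>s - m * \<mu>\<bar> \<ge> m * t})"
    by simp
  also have "\<dots> \<le> ?S (\<lambda>s. (s - m * \<mu>)\<^sup>2 / (m * t)\<^sup>2)"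
  proof (rule expectation_mono_finite)
    fix s
    have "(m * t)\<^sup>2 \<le> (s - m * \<mu>)\<^sup>2" if "m * t \<le> \<bar>s - m * \<mu>\<bar>"
      using that mt power_mono[of "m * t" "\<bar>s - m * \<mu>\<bar>" 2] by simp
    then show "indicator {s. \<bar>s - m * \<mu>\<bar> \<ge> m * t} s \<le> (s - m * \<mu>)\<^sup>2 / (m * t)\<^sup>2"
      using m t by (auto simp: indicator_def le_divide_eq)
  qed (simp add: finite_set_sum_pmf fin)
  also have "\<dots> \<le> m / (m * t)\<^sup>2"
    using var by (simp add: divide_right_mono)
  also have "\<dots> = 1 / (m * t\<^sup>2)"
    using m by (simp add: power2_eq_square)
  finally show ?thesis .
qed

subsection \<open>The tester\<close>

text \<open>The argument \<open>query\<close> is either \<open>QueryP\<close> or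
  \<open>QueryQ\<close>, so one program serves both distributions.\<close>

definition density_prog ::
    "(bool option list \<Rightarrow> (bool list \<Rightarrow> tester) \<Rightarrow> tester) \<Rightarrow> nat \<Rightarrow> real \<Rightarrow> nat \<Rightarrow> bool list \<Rightarrow>
     (real \<Rightarrow> tester) \<Rightarrow> tester" where
  "density_prog query N \<eta> n w =
     prod_prog n (\<lambda>i k.
       sum_prog N (\<lambda>k. query (prefix_query n w i) (\<lambda>v. k (of_bool (v ! i = w ! i))))
         (\<lambda>s. k ((1 - \<eta>) * (s / N) + \<eta> / 2)))"

definition gap_prog :: "nat \<Rightarrow> real \<Rightarrow> nat \<Rightarrow> (real \<Rightarrow> tester) \<Rightarrow> tester" where
  "gap_prog N \<eta> n k =
     QueryP (prefix_query n [] 0) (\<lambda>w.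
       density_prog QueryP N \<eta> n w (\<lambda>a. density_prog QueryQ N \<eta> n w (\<lambda>b. k (gap a b))))"

lemma implements_density_prog:
  assumes "\<And>\<rho>. length \<rho> = n \<Longrightarrow> implements n OP OQ (query \<rho>) (orc \<rho>) 1"
  shows "implements n OP OQ (density_prog query N \<eta> n w) (density_estimate N \<eta> n orc w) (n * N)"
proof -
  have "implements n OP OQ
      (\<lambda>k. sum_prog N (\<lambda>k. query (prefix_query n w i) (\<lambda>v. k (of_bool (v ! i = w ! i))))
         (\<lambda>s. k ((1 - \<eta>) * (s / N) + \<eta> / 2)))
      (tamed_estimate N \<eta> n orc w i) N" for i
    using implements_map[OF implements_sum_prog[OF implements_map[OF assms]],
        of "prefix_query n w i" N "\<lambda>v. of_bool (v ! i = w ! i)" "\<lambda>s. (1 - \<eta>) * (s / N) + \<eta> / 2"]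
    by (simp add: tamed_estimate_def bit_pmf_def)
  then show ?thesis
    unfolding density_prog_def density_estimate_def by (rule implements_prod_prog)
qed

text \<open>The all-star query conditions on a set of mass one, which changes nothing.\<close>

lemma oracle_full_cube:
  assumes "distr_on_cube n P" "subcond_oracle n P OP"
  shows "OP (prefix_query n [] 0) = P"
proof -
  have sub: "set_pmf P \<subseteq> bitstrings n"
    using assms by (simp add: distr_on_cube_def)
  then have one: "measure_pmf.prob P (bitstrings n) = 1"
    by (simp add: measure_pmf.prob_eq_1 AE_measure_pmf_iff subset_iff)
  have ne: "set_pmf P \<inter> bitstrings n \<noteq> {}"
    using sub set_pmf_not_empty[of P] by auto
  have "OP (prefix_query n [] 0) = cond_pmf P (bitstrings n)"
    using assms one by (simp add: subcond_oracle_def subcube_prefix_query)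
  also have "\<dots> = P"
    using sub by (intro pmf_eqI) (auto simp: pmf_cond[OF ne] one set_pmf_iff)
  finally show ?thesis .
qed

text \<open>One query draws \<open>w\<close>; each of the two density estimates spends
  \<open>N\<close> queries at each of the \<open>n\<close> positions.\<close>

lemma implements_gap_prog:
  assumes "distr_on_cube n P" "subcond_oracle n P OP"
  shows "implements n OP OQ (gap_prog N \<eta> n) (gap_pmf N \<eta> n P OP OQ) (1 + 2 * n * N)"
proof -
  have P: "implements n OP OQ (density_prog QueryP N \<eta> n w) (density_estimate N \<eta> n OP w) (n * N)"
    and Q: "implements n OP OQ (density_prog QueryQ N \<eta> n w) (density_estimate N \<eta> n OQ w) (n * N)"
    for w
    by (intro implements_density_prog implements_QueryP implements_QueryQ; simp)+
  have "implements n OP OQ (gap_prog N \<eta> n)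
      (bind_pmf (OP (prefix_query n [] 0)) (\<lambda>w. bind_pmf (density_estimate N \<eta> n OP w) (\<lambda>a.
         map_pmf (gap a) (density_estimate N \<eta> n OQ w)))) (1 + (n * N + n * N))"
    unfolding gap_prog_def
    by (intro implements_bind implements_QueryP implements_map P Q) simp
  then show ?thesis
    by (simp add: oracle_full_cube[OF assms] gap_pmf_def mult_2 distrib_right)
qed

definition distance_tester :: "nat \<Rightarrow> nat \<Rightarrow> real \<Rightarrow> real \<Rightarrow> nat \<Rightarrow> tester" where
  "distance_tester m N \<eta> \<theta> n =
     sum_prog m (gap_prog N \<eta> n) (\<lambda>s. Output (if s < m * \<theta> then Accept else Reject))"

lemma distance_tester_run:
  assumes "distr_on_cube n P" "subcond_oracle n P OP"
  shows "queries_of_length n (distance_tester m N \<eta> \<theta> n)"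
    and "run OP OQ (distance_tester m N \<eta> \<theta> n) =
      map_pmf (\<lambda>s. (if s < m * \<theta> then Accept else Reject, m * (1 + 2 * n * N)))
        (sum_pmf m (gap_pmf N \<eta> n P OP OQ))"
proof -
  have "implements n OP OQ (sum_prog m (gap_prog N \<eta> n)) (sum_pmf m (gap_pmf N \<eta> n P OP OQ))
      (m * (1 + 2 * n * N))" for OQ
    by (intro implements_sum_prog implements_gap_prog assms)
  then show "queries_of_length n (distance_tester m N \<eta> \<theta> n)"
    and "run OP OQ (distance_tester m N \<eta> \<theta> n) =
      map_pmf (\<lambda>s. (if s < m * \<theta> then Accept else Reject, m * (1 + 2 * n * N)))
        (sum_pmf m (gap_pmf N \<eta> n P OP OQ))"
    by (auto simp: distance_tester_def implements_def map_pmf_def bind_return_pmf)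
qed

text \<open>The midpoint threshold is \<open>e / 2\<close> away from both \<epsilon>1 and
  \<epsilon>2. Half of this margin pays for the bias and half for the fluctuation of the
  average.\<close>

lemma distance_tester_correct:
  fixes \<epsilon>1 \<epsilon>2 :: real
  assumes P: "distr_on_cube n P" and Q: "distr_on_cube n Q"
    and OP: "subcond_oracle n P OP" and OQ: "subcond_oracle n Q OQ"
    and n: "n > 0" and \<epsilon>: "0 < \<epsilon>2 - \<epsilon>1" "\<epsilon>2 - \<epsilon>1 \<le> 1"
    and N: "real N \<ge> 32768 * real n ^ 2 / (\<epsilon>2 - \<epsilon>1) ^ 3" and m: "real m \<ge> 40 / (\<epsilon>2 - \<epsilon>1) ^ 2"
  defines "t \<equiv> distance_tester m N ((\<epsilon>2 - \<epsilon>1) / (32 * n)) ((\<epsilon>1 + \<epsilon>2) / 2) n"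
  shows "d_TV n P Q < \<epsilon>1 \<Longrightarrow> prob_output OP OQ t Accept \<ge> 3 / 5"
    and "d_TV n P Q > \<epsilon>2 \<Longrightarrow> prob_output OP OQ t Reject \<ge> 3 / 5"
proof -
  define e \<eta> where "e = \<epsilon>2 - \<epsilon>1" and "\<eta> = (\<epsilon>2 - \<epsilon>1) / (32 * n)"
  have e: "0 < e" "e \<le> 1" using \<epsilon> by (simp_all add: e_def)
  have \<eta>_eq: "\<eta> = e / (32 * n)" by (simp add: \<eta>_def e_def)
  have \<eta>: "0 < \<eta>" "\<eta> \<le> 1" using e n by (auto simp: \<eta>_eq field_simps)
  have "0 < 32768 * real n ^ 2 / e ^ 3" "0 < 40 / e ^ 2" using e n by auto
  then have "0 < real N" "0 < real m"
    using N m unfolding e_def[symmetric] by linarith+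
  then have pos: "N > 0" "m > 0" by simp_all
  \<comment> \<open>\<open>v\<close> bounds the logarithm of the relative second moment. Since
    \<open>32768 = 64 * 512\<close>, the assumption on \<open>N\<close> gives
    \<open>v \<le> e\<^sup>2 / 512\<close>, so \<open>2 * v \<le> (e / 16)\<^sup>2\<close>.\<close>
  define v where "v = n * (2 / (\<eta> * N))"
  have v: "v = 64 * real n ^ 2 / (e * N)"
    using n by (simp add: v_def \<eta>_eq power2_eq_square)
  have "32768 * real n ^ 2 \<le> N * e ^ 3"
    using N e by (simp add: e_def[symmetric] divide_le_eq)
  then have v_le: "v \<le> e\<^sup>2 / 512"
    using e pos by (simp add: v divide_le_eq power2_eq_square power3_eq_cube algebra_simps)
  have "e\<^sup>2 \<le> 1" using e by (simp add: power_le_one)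
  then have v01: "0 \<le> v" "v \<le> 1"
    using v_le e by (simp_all add: v)
  have "(1 + 2 / (\<eta> * N)) ^ n \<le> exp (2 / (\<eta> * N)) ^ n"
    using \<eta> by (intro power_mono exp_ge_add_one_self) simp
  also have "\<dots> = exp v"
    unfolding v_def by (simp only: exp_of_nat_mult)
  also have "\<dots> \<le> 1 + v + v\<^sup>2"
    using v01 by (rule exp_bound)
  also have "\<dots> \<le> 1 + 2 * v"
    using v01 by (simp add: power2_eq_square mult_left_le)
  also have "\<dots> \<le> 1 + (e / 16)\<^sup>2"
    using v_le by (simp add: power_divide)
  finally have pow: "(1 + 2 / (\<eta> * N)) ^ n \<le> 1 + (e / 16)\<^sup>2" .
  let ?G = "gap_pmf N \<eta> n P OP OQ"
  define \<mu> where "\<mu> = measure_pmf.expectation ?G (\<lambda>z. z)"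
  \<comment> \<open>With \<open>\<delta> = e / 16\<close> and \<open>\<eta> = e / (32 * n)\<close>,
    estimation and taming contribute \<open>e / 8\<close> each.\<close>
  have "\<bar>\<mu> - d_TV n P Q\<bar> \<le> 2 * (e / 16) + 4 * real n * \<eta>"
    unfolding \<mu>_def using e \<eta> pos pow by (intro gap_pmf_expectation P Q OP OQ) auto
  also have "\<dots> = e / 4"
    using n by (simp add: \<eta>_eq)
  finally have "\<bar>\<mu> - d_TV n P Q\<bar> \<le> e / 4" .
  then have bias: "\<mu> \<le> d_TV n P Q + e / 4" "d_TV n P Q - e / 4 \<le> \<mu>"
    by linarith+
  define bad where "bad = {s. \<bar>s - m * \<mu>\<bar> \<ge> m * (e / 4)}"
  have "measure_pmf.prob (sum_pmf m ?G) bad \<le> 1 / (m * (e / 4)\<^sup>2)"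
    unfolding bad_def \<mu>_def using set_gap_pmf[OF \<eta>] e pos P
    by (intro sum_pmf_chebyshev finite_set_gap_pmf) auto
  \<comment> \<open>The constant \<open>40\<close> is chosen so that
    \<open>16 / 40 = 2 / 5\<close>.\<close>
  also have "\<dots> \<le> 2 / 5"
  proof -
    have "40 \<le> m * e\<^sup>2"
      using m e by (simp add: e_def[symmetric] divide_le_eq)
    then show ?thesis
      using e pos by (simp add: power_divide field_simps)
  qed
  finally have bad: "measure_pmf.prob (sum_pmf m ?G) bad \<le> 2 / 5" .
  have good: "measure_pmf.prob (sum_pmf m ?G) A \<ge> 3 / 5" if "- bad \<subseteq> A" for A
  proof -
    have "measure_pmf.prob (sum_pmf m ?G) (- bad) = 1 - measure_pmf.prob (sum_pmf m ?G) bad"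
      using measure_pmf.prob_compl[of bad "sum_pmf m ?G"] by (simp add: Compl_eq_Diff_UNIV)
    moreover have "measure_pmf.prob (sum_pmf m ?G) (- bad) \<le> measure_pmf.prob (sum_pmf m ?G) A"
      using that by (intro measure_pmf.finite_measure_mono) auto
    ultimately show ?thesis using bad by linarith
  qed
  have output_prob: "prob_output OP OQ t V = measure_pmf.prob (sum_pmf m ?G)
      {s. (if s < m * ((\<epsilon>1 + \<epsilon>2) / 2) then Accept else Reject) = V}" for V
    by (simp add: prob_output_def t_def distance_tester_run[OF P OP] \<eta>_def vimage_def)
  have close: "m * (\<mu> - e / 4) < s \<and> s < m * (\<mu> + e / 4)" if "s \<in> - bad" for s
    using that unfolding bad_def right_diff_distrib distrib_left Compl_iff mem_Collect_eq by linarith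
  show "prob_output OP OQ t Accept \<ge> 3 / 5" if "d_TV n P Q < \<epsilon>1"
  proof -
    have "\<mu> + e / 4 \<le> (\<epsilon>1 + \<epsilon>2) / 2" using that bias by (simp add: e_def field_simps)
    then have "m * (\<mu> + e / 4) \<le> m * ((\<epsilon>1 + \<epsilon>2) / 2)" by (intro mult_left_mono) auto
    then show ?thesis
      unfolding output_prob using close by (intro good) fastforce
  qed
  show "prob_output OP OQ t Reject \<ge> 3 / 5" if "d_TV n P Q > \<epsilon>2"
  proof -
    have "(\<epsilon>1 + \<epsilon>2) / 2 \<le> \<mu> - e / 4" using that bias by (simp add: e_def field_simps)
    then have "m * ((\<epsilon>1 + \<epsilon>2) / 2) \<le> m * (\<mu> - e / 4)" by (intro mult_left_mono) auto
    then show ?thesis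
      unfolding output_prob using close by (intro good) fastforce
  qed
qed

text \<open>Each rounding up costs at most one, absorbed because \<open>1 / e ^ j\<close> and
  \<open>n ^ j\<close> are at least one: \<open>41 = 40 + 1\<close>,
  \<open>32769 = 32768 + 1\<close>, and \<open>65539 = 2 * 32769 + 1\<close> includes the query for
  \<open>w\<close>.\<close>

lemma query_count_bound:
  fixes e :: real
  assumes n: "n > 0" and e: "0 < e" "e \<le> 1"
  shows "real (nat \<lceil>40 / e ^ 2\<rceil> * (1 + 2 * n * nat \<lceil>32768 * real n ^ 2 / e ^ 3\<rceil>)) \<le>
    41 * 65539 * (real n ^ 3 / e ^ 5)"
proof -
  have inv: "1 \<le> 1 / e ^ j" for j
    using e by (simp add: power_le_one)
  have n1: "1 \<le> real n ^ j" for j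
    using n by (intro one_le_power) simp
  have ceil: "real (nat \<lceil>x\<rceil>) \<le> x + 1" if "x \<ge> 0" for x :: real
    using that by linarith
  have m: "real (nat \<lceil>40 / e ^ 2\<rceil>) \<le> 41 / e ^ 2"
  proof -
    have "41 / e ^ 2 = 40 / e ^ 2 + 1 / e ^ 2" by (simp flip: add_divide_distrib)
    moreover have "0 \<le> 40 / e ^ 2" by simp
    ultimately show ?thesis using ceil[of "40 / e ^ 2"] inv[of 2] by linarith
  qed
  have "1 \<le> real n ^ 2 * (1 / e ^ 3)"
    using mult_mono[OF n1[of 2] inv[of 3]] by simp
  have N: "real (nat \<lceil>32768 * real n ^ 2 / e ^ 3\<rceil>) \<le> 32769 * (real n ^ 2 * (1 / e ^ 3))"
  proof -
    have "32769 * (real n ^ 2 * (1 / e ^ 3)) = 32768 * real n ^ 2 / e ^ 3 + real n ^ 2 * (1 / e ^ 3)"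
      by (simp add: field_simps)
    moreover have "0 \<le> 32768 * real n ^ 2 / e ^ 3" using e by simp
    ultimately show ?thesis
      using ceil[of "32768 * real n ^ 2 / e ^ 3"] \<open>1 \<le> real n ^ 2 * (1 / e ^ 3)\<close> by linarith
  qed
  have one: "1 \<le> real n ^ 3 * (1 / e ^ 3)"
    using mult_mono[OF n1[of 3] inv[of 3]] by simp
  have "real (1 + 2 * n * nat \<lceil>32768 * real n ^ 2 / e ^ 3\<rceil>) \<le>
      real n ^ 3 * (1 / e ^ 3) + 2 * real n * (32769 * (real n ^ 2 * (1 / e ^ 3)))"
    using one mult_left_mono[OF N, of "2 * real n"] by (simp only: of_nat_add of_nat_mult) simp
  also have "\<dots> = 65539 * (real n ^ 3 * (1 / e ^ 3))"
    by (simp add: power2_eq_square power3_eq_cube)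
  finally have "real (nat \<lceil>40 / e ^ 2\<rceil>) * real (1 + 2 * n * nat \<lceil>32768 * real n ^ 2 / e ^ 3\<rceil>) \<le>
      41 / e ^ 2 * (65539 * (real n ^ 3 * (1 / e ^ 3)))"
    using m e by (intro mult_mono) (auto simp del: of_nat_add of_nat_mult)
  also have "\<dots> = 41 * 65539 * (real n ^ 3 / e ^ 5)"
    by (simp flip: power_add)
  finally show ?thesis by (simp only: of_nat_mult)
qed

theorem theorem1:
  "\<exists>(alg :: nat \<Rightarrow> real \<Rightarrow> real \<Rightarrow> tester) (B :: nat \<times> real \<times> real \<Rightarrow> real).
     B \<in> soft_bigo tester_params (\<lambda>(n, \<epsilon>1, \<epsilon>2). real n ^ 3 / (\<epsilon>2 - \<epsilon>1) ^ 5) \<and>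
     (\<forall>n \<epsilon>1 \<epsilon>2 P Q OP OQ.
        (n, \<epsilon>1, \<epsilon>2) \<in> tester_params \<longrightarrow>
        distr_on_cube n P \<longrightarrow> distr_on_cube n Q \<longrightarrow>
        subcond_oracle n P OP \<longrightarrow> subcond_oracle n Q OQ \<longrightarrow>
          queries_of_length n (alg n \<epsilon>1 \<epsilon>2) \<and>
          (\<forall>(v, q) \<in> set_pmf (run OP OQ (alg n \<epsilon>1 \<epsilon>2)). real q \<le> B (n, \<epsilon>1, \<epsilon>2)) \<and>
          (d_TV n P Q < \<epsilon>1 \<longrightarrow> prob_output OP OQ (alg n \<epsilon>1 \<epsilon>2) Accept \<ge> 3 / 5) \<and>
          (d_TV n P Q > \<epsilon>2 \<longrightarrow> prob_output OP OQ (alg n \<epsilon>1 \<epsilon>2) Reject \<ge> 3 / 5))"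
proof -
  define g :: "nat \<times> real \<times> real \<Rightarrow> real"
    where "g = (\<lambda>(n, \<epsilon>1, \<epsilon>2). real n ^ 3 / (\<epsilon>2 - \<epsilon>1) ^ 5)"
  define B where "B = (\<lambda>x. 41 * 65539 * g x)"
  \<comment> \<open>the bound allows no query at all for \<open>n = 0\<close>, where the distance is \<open>0\<close>\<close>
  define alg where "alg n \<epsilon>1 \<epsilon>2 =
    (if n = 0 then Output Accept
     else distance_tester (nat \<lceil>40 / (\<epsilon>2 - \<epsilon>1) ^ 2\<rceil>) (nat \<lceil>32768 * real n ^ 2 / (\<epsilon>2 - \<epsilon>1) ^ 3\<rceil>)
       ((\<epsilon>2 - \<epsilon>1) / (32 * n)) ((\<epsilon>1 + \<epsilon>2) / 2) n)" for n :: nat and \<epsilon>1 \<epsilon>2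
  have "B \<in> soft_bigo tester_params g"
    unfolding soft_bigo_def mem_Collect_eq
  proof
    \<comment> \<open>The bound holds without any logarithm, so the exponent is
      \<open>0\<close>.\<close>
    show "B \<in> O[principal tester_params](\<lambda>x. g x * log 2 (2 + g x) ^ 0)"
      by (simp add: B_def)
  qed
  moreover have "queries_of_length n (alg n \<epsilon>1 \<epsilon>2) \<and>
      (\<forall>(v, q) \<in> set_pmf (run OP OQ (alg n \<epsilon>1 \<epsilon>2)). real q \<le> B (n, \<epsilon>1, \<epsilon>2)) \<and>
      (d_TV n P Q < \<epsilon>1 \<longrightarrow> prob_output OP OQ (alg n \<epsilon>1 \<epsilon>2) Accept \<ge> 3 / 5) \<and>
      (d_TV n P Q > \<epsilon>2 \<longrightarrow> prob_output OP OQ (alg n \<epsilon>1 \<epsilon>2) Reject \<ge> 3 / 5)"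
    if params: "(n, \<epsilon>1, \<epsilon>2) \<in> tester_params" and P: "distr_on_cube n P" and Q: "distr_on_cube n Q"
      and OP: "subcond_oracle n P OP" and OQ: "subcond_oracle n Q OQ" for n \<epsilon>1 \<epsilon>2 P Q OP OQ
  proof (cases "n = 0")
    case True
    have "pmf D [] = 1" if "distr_on_cube 0 D" for D
      using that by (simp add: distr_on_cube_def bitstrings_0 set_pmf_subset_singleton)
    then have "d_TV n P Q = 0"
      using P Q True by (simp add: d_TV_def bitstrings_0)
    \<comment> \<open>Distance zero cannot exceed \<epsilon>2, so always accepting is correct and
      only the first implication has content.\<close>
    then show ?thesis
      using True params by (auto simp: alg_def B_def g_def prob_output_def tester_params_def)
  next
    case False
    have \<epsilon>: "0 < \<epsilon>2 - \<epsilon>1" "\<epsilon>2 - \<epsilon>1 \<le> 1"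
      using params by (auto simp: tester_params_def)
    have "real (nat \<lceil>40 / (\<epsilon>2 - \<epsilon>1) ^ 2\<rceil> * (1 + 2 * n * nat \<lceil>32768 * real n ^ 2 / (\<epsilon>2 - \<epsilon>1) ^ 3\<rceil>)) \<le>
        B (n, \<epsilon>1, \<epsilon>2)"
      using query_count_bound[of n "\<epsilon>2 - \<epsilon>1"] \<epsilon> False by (simp add: B_def g_def)
    then have "\<forall>(v, q) \<in> set_pmf (run OP OQ (alg n \<epsilon>1 \<epsilon>2)). real q \<le> B (n, \<epsilon>1, \<epsilon>2)"
      using False by (auto simp only: alg_def distance_tester_run[OF P OP] set_map_pmf if_False)
    moreover have "queries_of_length n (alg n \<epsilon>1 \<epsilon>2)"
      using False distance_tester_run(1)[OF P OP] by (simp add: alg_def)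
    ultimately show ?thesis
      using distance_tester_correct[OF P Q OP OQ _ \<epsilon> real_nat_ceiling_ge real_nat_ceiling_ge] False
      by (simp add: alg_def)
  qed
  ultimately show ?thesis
    unfolding g_def by blast
qed

end
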